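(* Let $X$ be a real Banach lattice whose norm is strictly monotone, let $E\subset X$ be a closed subspace, and let $(e_n)_{n\in\mathbb{N}}$ be a semi-normalized basis of $E$. The following are equivalent: (i) $(e_n)$ is 1-bibasic; (ii) $(e_n)$ is 1-uniformly quasi-greedy; (iii) the vectors $e_n$ are pairwise disjoint, i.e. $|e_i|\wedge|e_j|=0$ for all $i\neq j$.
   Context: All Banach spaces are over $\mathbb{R}$; $E$ carries the norm of $X$. "Basis" means Schauder basis; semi-normalized means $0<\inf_n\|e_n\|\le\sup_n\|e_n\|<\infty$; $e_n^*$ denotes the biorthogonal (coefficient) functionals and $\mathrm{supp}(x)=\{n: e_n^*(x)\ne 0\}$. The norm on $X$ is strictly monotone if for all $x,y\in X$, $|x|<|y|$ (that is, $|x|\le|y|$ and $|x|\ne|y|$) implies $\|x\|<\|y\|$. 1-bibasic: for all $m\in\mathbb{N}$ and all scalars $\alpha_1,\dots,\alpha_m$, $\left\|\bigvee_{n=1}^m\left|\sum_{k=1}^n\alpha_k e_k\right|\right\|\le\left\|\sum_{k=1}^m\alpha_k e_k\right\|$. A greedy ordering of $x\in E$ is an injective map $\pi:\mathbb{N}\to\mathbb{N}$ with $\mathrm{supp}(x)\subset\pi(\mathbb{N})$ such that $(|e^*_{\pi(n)}(x)|)_n$ is non-increasing. The natural greedy ordering $\sigma$ of $x$ is the greedy ordering such that $j<k$ implies either $|e^*_{\sigma(j)}(x)|>|e^*_{\sigma(k)}(x)|$, or $|e^*_{\sigma(j)}(x)|=|e^*_{\sigma(k)}(x)|$ and $\sigma(j)<\sigma(k)$.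 The $m$-th natural greedy sum is $\mathcal{G}_m(x)=\sum_{n=1}^m e^*_{\sigma(n)}(x)e_{\sigma(n)}$. 1-uniformly quasi-greedy (uniformly quasi-greedy constant equal to $1$): for all $m\in\mathbb{N}$ and $x\in E$, $\left\|\bigvee_{n=1}^m|\mathcal{G}_n(x)|\right\|\le\|x\|$. *)

theory Defs
  imports "HOL-Analysis.Analysis" "HOL-Library.Lattice_Algebras"
begin

class banach_lattice = banach + ordered_real_vector + lattice_ab_group_add_abs +
  assumes norm_mono_abs: "\<bar>x\<bar> \<le> \<bar>y\<bar> \<Longrightarrow> norm x \<le> norm y"

definition strictly_monotone_norm :: "'a::banach_lattice itself \<Rightarrow> bool" where
  "strictly_monotone_norm _ \<longleftrightarrow> (\<forall>x y :: 'a. \<bar>x\<bar> < \<bar>y\<bar> \<longrightarrow> norm x < norm y)"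

definition disjoint_vectors :: "'a::banach_lattice \<Rightarrow> 'a \<Rightarrow> bool" where
  "disjoint_vectors x y \<longleftrightarrow> inf \<bar>x\<bar> \<bar>y\<bar> = 0"

text \<open>Sequences are indexed from 0, so the first \<open>n\<close> basis vectors are \<open>e k\<close> with \<open>k < n\<close>.\<close>

definition schauder_basis_of :: "'a::real_normed_vector set \<Rightarrow> (nat \<Rightarrow> 'a) \<Rightarrow> bool" where
  "schauder_basis_of E e \<longleftrightarrow>
     (\<forall>n. e n \<in> E) \<and> (\<forall>x\<in>E. \<exists>!a. (\<lambda>n. a n *\<^sub>R e n) sums x)"

definition semi_normalized :: "(nat \<Rightarrow> 'a::real_normed_vector) \<Rightarrow> bool" where
  "semi_normalized e \<longleftrightarrow>
     0 < (INF n. norm (e n)) \<and> bdd_above (range (\<lambda>n. norm (e n)))"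

text \<open>\<open>basis_coeff e n x\<close> is \<open>e\<^sub>n\<^sup>*(x)\<close>; it is meaningful only for \<open>x\<close> in the space of
  which \<open>e\<close> is a basis.\<close>

definition basis_coeff :: "(nat \<Rightarrow> 'a::real_normed_vector) \<Rightarrow> nat \<Rightarrow> 'a \<Rightarrow> real" where
  "basis_coeff e n x = (THE a. (\<lambda>k. a k *\<^sub>R e k) sums x) n"

definition basis_supp :: "(nat \<Rightarrow> 'a::real_normed_vector) \<Rightarrow> 'a \<Rightarrow> nat set" where
  "basis_supp e x = {n. basis_coeff e n x \<noteq> 0}"

definition one_bibasic :: "(nat \<Rightarrow> 'a::banach_lattice) \<Rightarrow> bool" where
  "one_bibasic e \<longleftrightarrow>
     (\<forall>m\<ge>1. \<forall>\<alpha> :: nat \<Rightarrow> real.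
        norm (Sup_fin ((\<lambda>n. \<bar>\<Sum>k<n. \<alpha> k *\<^sub>R e k\<bar>) ` {1..m})) \<le> norm (\<Sum>k<m. \<alpha> k *\<^sub>R e k))"

definition greedy_ordering ::
    "(nat \<Rightarrow> 'a::real_normed_vector) \<Rightarrow> 'a \<Rightarrow> (nat \<Rightarrow> nat) \<Rightarrow> bool" where
  "greedy_ordering e x \<pi> \<longleftrightarrow>
     inj \<pi> \<and> basis_supp e x \<subseteq> range \<pi> \<and> decseq (\<lambda>n. \<bar>basis_coeff e (\<pi> n) x\<bar>)"

definition natural_greedy_ordering ::
    "(nat \<Rightarrow> 'a::real_normed_vector) \<Rightarrow> 'a \<Rightarrow> (nat \<Rightarrow> nat) \<Rightarrow> bool" where
  "natural_greedy_ordering e x \<sigma> \<longleftrightarrow>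
     greedy_ordering e x \<sigma> \<and>
     (\<forall>j k. j < k \<longrightarrow>
        \<bar>basis_coeff e (\<sigma> j) x\<bar> > \<bar>basis_coeff e (\<sigma> k) x\<bar> \<or>
        \<bar>basis_coeff e (\<sigma> j) x\<bar> = \<bar>basis_coeff e (\<sigma> k) x\<bar> \<and> \<sigma> j < \<sigma> k)"

text \<open>For a semi-normalized basis the coefficients of \<open>x\<close> tend to 0, so a natural greedy ordering
  exists. It is unique on the support of \<open>x\<close>; if the support is finite, the remaining values may
  form any increasing sequence outside it. These indices have zero coefficient, so the greedy sums
  below do not depend on the ordering chosen.\<close>

definition greedy_sum ::
    "(nat \<Rightarrow> 'a::real_normed_vector) \<Rightarrow> nat \<Rightarrow> 'a \<Rightarrow> 'a" where
  "greedy_sum e m x =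
     (let \<sigma> = (SOME \<sigma>. natural_greedy_ordering e x \<sigma>)
      in \<Sum>n<m. basis_coeff e (\<sigma> n) x *\<^sub>R e (\<sigma> n))"

definition one_uniformly_quasi_greedy ::
    "'a::banach_lattice set \<Rightarrow> (nat \<Rightarrow> 'a) \<Rightarrow> bool" where
  "one_uniformly_quasi_greedy E e \<longleftrightarrow>
     (\<forall>m\<ge>1. \<forall>x\<in>E. norm (Sup_fin ((\<lambda>n. \<bar>greedy_sum e n x\<bar>) ` {1..m})) \<le> norm x)"

end

theory Submission
  imports Defs
begin

text \<open>
  By strict monotonicity, (i) and (ii) turn into order statements: if the norm of
  \<open>\<Squnion>\<^sub>n \<bar>s\<^sub>n\<bar>\<close> is at most that of its last member \<open>\<bar>s\<^sub>m\<bar>\<close>, the two are equal, so every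
  \<open>\<bar>s\<^sub>n\<bar> \<le> \<bar>s\<^sub>m\<bar>\<close>. For (i) this gives \<open>\<bar>e\<^sub>i\<bar> \<le> \<bar>e\<^sub>i + t e\<^sub>j\<bar>\<close> for \<open>i < j\<close> and all real \<open>t\<close>; for (ii)
  it gives \<open>\<bar>e\<^sub>i\<bar> \<le> \<bar>e\<^sub>i \<plusminus> e\<^sub>j / 2\<bar>\<close> for all \<open>i \<noteq> j\<close>. In a vector lattice
  \<open>\<bar>x + y\<bar> \<sqinter> \<bar>x - y\<bar> \<le> \<bar>\<bar>x\<bar> - \<bar>y\<bar>\<bar> = \<bar>x\<bar> + \<bar>y\<bar> - 2 (\<bar>x\<bar> \<sqinter> \<bar>y\<bar>)\<close>, so either family of inequalities
  forces \<open>\<bar>e\<^sub>i\<bar> \<sqinter> \<bar>e\<^sub>j\<bar> = 0\<close>. Conversely, for disjoint vectors the modulus of a sum is the sum of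
  the moduli, which makes the moduli of the partial sums and of the greedy sums increasing.
\<close>

section \<open>Lattice-ordered groups\<close>

text \<open>Distributivity comes from the group: every \<open>w\<close> below
  \<open>s = sup y z\<close> with \<open>inf x w \<le> d\<close> also lies below
  \<open>s - (inf x s - d)\<close>. Taking \<open>y\<close> and \<open>z\<close> for
  \<open>w\<close> gives \<open>s \<le> s - (inf x s - d)\<close>, hence
  \<open>inf x s \<le> d\<close>.\<close>

lemma inf_sup_le_sup_inf:
  fixes x y z :: "'a::lattice_ab_group_add"
  shows "inf x (sup y z) \<le> sup (inf x y) (inf x z)"
proof -
  define s where "s = sup y z"
  define d where "d = sup (inf x y) (inf x z)"
  have *: "w \<le> s - (inf x s - d)" if "w \<le> s" "inf x w \<le> d" for w
  proof -
    \<comment> \<open>Writing \<open>x + s\<close> and \<open>x + w\<close> as infimum plus supremum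
      leaves two nonnegative summands.\<close>
    have "s - (inf x s - d) - w = (x + s) - (x + w) - inf x s + d"
      by (simp add: algebra_simps del: diff_inf_eq_sup diff_sup_eq_inf)
    also have "\<dots> = (sup x s - sup x w) + (d - inf x w)" (is "_ = ?r")
      unfolding add_eq_inf_sup[of x s] add_eq_inf_sup[of x w]
      by (simp add: algebra_simps del: diff_inf_eq_sup diff_sup_eq_inf)
    finally have eq: "s - (inf x s - d) - w = ?r" .
    have "0 \<le> ?r"
      using that by (intro add_nonneg_nonneg)
        (simp_all add: sup_mono le_supI2 del: diff_inf_eq_sup diff_sup_eq_inf)
    then show ?thesis
      by (simp only: diff_ge_0_iff_ge flip: eq)
  qed
  have "s \<le> s - (inf x s - d)"
    unfolding s_def by (rule le_supI; fold s_def; rule *) (simp_all add: s_def d_def)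
  then show ?thesis
    unfolding s_def d_def
    by (metis diff_le_0_iff_le le_diff_eq add_le_same_cancel1)
qed

lemma abs_diff_eq_sup_minus_inf:
  fixes x y :: "'a::lattice_ab_group_add_abs"
  shows "\<bar>x - y\<bar> = sup x y - inf x y"
proof -
  have "sup x y - inf x y = sup (sup (x - x) (y - x)) (sup (x - y) (y - y))"
    by (simp add: add_sup_inf_distribs algebra_simps sup_aci)
  also have "\<dots> = sup 0 \<bar>x - y\<bar>"
    by (simp add: abs_lattice sup_aci)
  also have "\<dots> = \<bar>x - y\<bar>"
    by (simp add: sup_absorb2)
  finally show ?thesis by simp
qed

lemma abs_diff_eq_minus_double_inf:
  fixes x y :: "'a::lattice_ab_group_add_abs"
  shows "\<bar>x - y\<bar> = x + y - (inf x y + inf x y)"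
  using add_eq_inf_sup[of x y]
  by (simp add: abs_diff_eq_sup_minus_inf algebra_simps del: diff_inf_eq_sup diff_sup_eq_inf)

text \<open>Each modulus on the left is the supremum of a vector and its negative, so distributivity
  leaves four infima. Each has the form \<open>a - |b|\<close> and lies below
  \<open>|x| - |y|\<close> or \<open>|y| - |x|\<close>.\<close>

lemma inf_abs_add_abs_diff_le:
  fixes x y :: "'a::lattice_ab_group_add_abs"
  shows "inf (\<bar>x + y\<bar>) (\<bar>x - y\<bar>) \<le> \<bar>\<bar>x\<bar> - \<bar>y\<bar>\<bar>"
proof -
  define r where "r = \<bar>\<bar>x\<bar> - \<bar>y\<bar>\<bar>"
  have r: "\<bar>x\<bar> - \<bar>y\<bar> \<le> r" "\<bar>y\<bar> - \<bar>x\<bar> \<le> r"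
    unfolding r_def using abs_ge_self[of "\<bar>x\<bar> - \<bar>y\<bar>"] abs_ge_minus_self[of "\<bar>x\<bar> - \<bar>y\<bar>"] by simp_all
  have inf_eq: "inf (a + b) (a - b) = a - \<bar>b\<bar>" for a b :: 'a
    by (simp add: abs_lattice add_inf_distrib_left inf_commute)
  have comm: "- y - x = - x - y"
    by (simp add: algebra_simps)
  have "inf (x + y) (x - y) = x - \<bar>y\<bar>" "inf (- x - y) (- (x - y)) = - x - \<bar>y\<bar>"
    "inf (x + y) (- (x - y)) = y - \<bar>x\<bar>" "inf (- x - y) (x - y) = - y - \<bar>x\<bar>"
    using inf_eq[of x y] inf_eq[of "- x" y] inf_eq[of y x] inf_eq[of "- y" x]
    by (simp_all add: inf_commute add.commute comm)
  then have le: "inf (x + y) (x - y) \<le> r" "inf (- x - y) (- (x - y)) \<le> r"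
    "inf (x + y) (- (x - y)) \<le> r" "inf (- x - y) (x - y) \<le> r"
    using r by (metis abs_ge_self abs_ge_minus_self diff_right_mono order_trans)+
  have "inf \<bar>x + y\<bar> w \<le> sup (inf (x + y) w) (inf (- x - y) w)" for w
    using inf_sup_le_sup_inf[of w "x + y" "- x - y"] by (simp add: abs_lattice inf_commute)
  moreover have "inf v \<bar>x - y\<bar> \<le> sup (inf v (x - y)) (inf v (- (x - y)))" for v
    using inf_sup_le_sup_inf[of v "x - y" "- (x - y)"] by (simp only: abs_lattice)
  ultimately show ?thesis
    unfolding r_def[symmetric] using le by (meson le_supI order_trans)
qed

lemma double_inf_abs_le:
  fixes x y :: "'a::lattice_ab_group_add_abs"
  assumes "\<bar>x\<bar> \<le> \<bar>x + y\<bar>" and "\<bar>x\<bar> \<le> \<bar>x - y\<bar>"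
  shows "inf \<bar>x\<bar> \<bar>y\<bar> + inf \<bar>x\<bar> \<bar>y\<bar> \<le> \<bar>y\<bar>"
proof -
  have "\<bar>x\<bar> \<le> \<bar>\<bar>x\<bar> - \<bar>y\<bar>\<bar>"
    using assms inf_abs_add_abs_diff_le[of x y] by (meson inf_greatest order_trans)
  then show ?thesis
    by (simp add: abs_diff_eq_minus_double_inf algebra_simps del: diff_inf_eq_sup)
qed

lemma abs_add_disjoint:
  fixes x y :: "'a::lattice_ab_group_add_abs"
  assumes "inf \<bar>x\<bar> \<bar>y\<bar> = 0"
  shows "\<bar>x + y\<bar> = \<bar>x\<bar> + \<bar>y\<bar>"
proof (rule antisym)
  \<comment> \<open>Disjointness removes the infimum from the formula for the modulus of a
    difference; \<open>- y\<close> replaces \<open>y\<close> so that the reverse triangle inequality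
    ends at \<open>x + y\<close>.\<close>
  have "\<bar>x\<bar> + \<bar>y\<bar> = \<bar>\<bar>x\<bar> - \<bar>- y\<bar>\<bar>"
    using assms by (simp add: abs_diff_eq_minus_double_inf)
  also have "\<dots> \<le> \<bar>x + y\<bar>"
    using abs_triangle_ineq3[of x "- y"] by simp
  finally show "\<bar>x\<bar> + \<bar>y\<bar> \<le> \<bar>x + y\<bar>" .
qed (rule abs_triangle_ineq)

text \<open>Enlarging \<open>x\<close> to \<open>x + z\<close> lets the shift by \<open>z\<close>
  leave the infimum, so \<open>inf x (y + z)\<close> lies below \<open>z\<close> as well as below
  \<open>x\<close>.\<close>

lemma inf_add_eq_0:
  fixes x y z :: "'a::lattice_ab_group_add"
  assumes "0 \<le> x" "0 \<le> y" "0 \<le> z" and "inf x y = 0" and "inf x z = 0"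
  shows "inf x (y + z) = 0"
proof (rule antisym)
  have "inf x (y + z) \<le> inf (x + z) (y + z)"
    using assms(3) by (intro inf_mono) (simp_all add: add_increasing2)
  also have "\<dots> = z"
    using assms(4) by (simp flip: add_inf_distrib_right)
  finally show "inf x (y + z) \<le> 0"
    using assms(5) by (metis inf_greatest inf_le1)
qed (use assms in simp)

lemma abs_sum_disjoint:
  fixes f :: "'i \<Rightarrow> 'a::lattice_ab_group_add_abs"
  assumes "finite A"
    and "\<And>i j. i \<in> A \<Longrightarrow> j \<in> A \<Longrightarrow> i \<noteq> j \<Longrightarrow> inf \<bar>f i\<bar> \<bar>f j\<bar> = 0"
  shows "\<bar>sum f A\<bar> = (\<Sum>i\<in>A. \<bar>f i\<bar>)"
  using assms
proof (induction A)
  case (insert a A)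
  note disjoint = insert.prems
  \<comment> \<open>The inner induction makes \<open>f a\<close> disjoint from the sum of the
    remaining moduli, which by the outer hypothesis is the modulus of
    \<open>sum f A\<close>.\<close>
  have "inf \<bar>f a\<bar> (\<Sum>i\<in>B. \<bar>f i\<bar>) = 0" if "finite B" "B \<subseteq> A" for B
    using that
  proof (induction B)
    case (insert b B)
    then show ?case
      using disjoint[of a b] \<open>a \<notin> A\<close>
      by (auto intro!: inf_add_eq_0 sum_nonneg)
  qed (simp add: inf_absorb2)
  with insert show ?case
    by (simp add: abs_add_disjoint)
qed simp

section \<open>Banach lattices\<close>

lemma norm_abs_banach_lattice:
  fixes x :: "'a::banach_lattice"
  shows "norm \<bar>x\<bar> = norm x"
  by (rule antisym) (simp_all add: norm_mono_abs)

lemma abs_scaleR_banach_lattice: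
  fixes x :: "'a::banach_lattice"
  shows "\<bar>a *\<^sub>R x\<bar> = \<bar>a\<bar> *\<^sub>R \<bar>x\<bar>"
proof (rule antisym)
  have le: "\<bar>b *\<^sub>R y\<bar> \<le> \<bar>b\<bar> *\<^sub>R \<bar>y\<bar>" for b and y :: 'a
  proof -
    have "c *\<^sub>R z \<le> \<bar>c\<bar> *\<^sub>R \<bar>z\<bar>" for c and z :: 'a
    proof (cases "0 \<le> c")
      case True
      then show ?thesis by (simp add: scaleR_left_mono abs_ge_self)
    next
      case False
      then have "(- c) *\<^sub>R (- z) \<le> (- c) *\<^sub>R \<bar>z\<bar>"
        by (intro scaleR_left_mono abs_ge_minus_self) simp
      with False show ?thesis by simp
    qed
    from this[of b y] this[of "- b" y] show ?thesis
      by (intro abs_leI) simp_all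
  qed
  then show "\<bar>a *\<^sub>R x\<bar> \<le> \<bar>a\<bar> *\<^sub>R \<bar>x\<bar>" .
  show "\<bar>a\<bar> *\<^sub>R \<bar>x\<bar> \<le> \<bar>a *\<^sub>R x\<bar>"
  proof (cases "a = 0")
    case False
    \<comment> \<open>The bound already proved, applied to \<open>a *\<^sub>R x\<close> and the
      scalar \<open>inverse a\<close>, gives the reverse one.\<close>
    have "\<bar>a\<bar> *\<^sub>R \<bar>inverse a *\<^sub>R (a *\<^sub>R x)\<bar> \<le> \<bar>a\<bar> *\<^sub>R (\<bar>inverse a\<bar> *\<^sub>R \<bar>a *\<^sub>R x\<bar>)"
      by (intro scaleR_left_mono le) simp
    with False show ?thesis
      by (simp flip: abs_mult)
  qed simp
qed

lemma disjoint_vectors_sym: "disjoint_vectors x y \<Longrightarrow> disjoint_vectors y x"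
  by (simp add: disjoint_vectors_def inf_commute)

lemma disjoint_vectors_scaleR:
  assumes "disjoint_vectors x y"
  shows "disjoint_vectors x (a *\<^sub>R y)"
proof -
  \<comment> \<open>Division by a scalar that is at least 1 and at least \<open>|a|\<close> puts
    \<open>w\<close> below both \<open>|x|\<close> and \<open>|y|\<close>, whose infimum is
    0.\<close>
  define c where "c = max 1 \<bar>a\<bar>"
  have c: "1 \<le> c" "\<bar>a\<bar> \<le> c" by (auto simp: c_def)
  define w where "w = inf \<bar>x\<bar> (\<bar>a\<bar> *\<^sub>R \<bar>y\<bar>)"
  have w: "w \<le> \<bar>x\<bar>" "w \<le> \<bar>a\<bar> *\<^sub>R \<bar>y\<bar>" "0 \<le> w"
    by (simp_all add: w_def scaleR_nonneg_nonneg)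
  have "\<bar>x\<bar> \<le> c *\<^sub>R \<bar>x\<bar>" "\<bar>a\<bar> *\<^sub>R \<bar>y\<bar> \<le> c *\<^sub>R \<bar>y\<bar>"
    using scaleR_right_mono[OF c(1), of "\<bar>x\<bar>"] scaleR_right_mono[OF c(2), of "\<bar>y\<bar>"] by simp_all
  with w have "w /\<^sub>R c \<le> \<bar>x\<bar>" "w /\<^sub>R c \<le> \<bar>y\<bar>"
    using c by (auto simp: pos_divideR_le_eq intro: order_trans)
  then have "w /\<^sub>R c \<le> 0"
    using assms unfolding disjoint_vectors_def by (metis inf_greatest)
  then have "w \<le> 0"
    using c by (simp add: pos_divideR_le_eq)
  then have "w = 0"
    using w(3) by (rule antisym)
  then show ?thesis
    by (simp add: disjoint_vectors_def abs_scaleR_banach_lattice w_def)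
qed

text \<open>A single size of coefficient suffices because \<open>x\<close> and \<open>y\<close> may
  exchange roles: twice the infimum \<open>w\<close> of the moduli lies below each of them, so
  \<open>w + w \<le> w\<close>.\<close>

lemma disjoint_vectors_if_halves:
  fixes x y :: "'a::banach_lattice"
  assumes "\<And>t. \<bar>t\<bar> = 1/2 \<Longrightarrow> \<bar>x\<bar> \<le> \<bar>x + t *\<^sub>R y\<bar>"
    and "\<And>t. \<bar>t\<bar> = 1/2 \<Longrightarrow> \<bar>y\<bar> \<le> \<bar>y + t *\<^sub>R x\<bar>"
  shows "disjoint_vectors x y"
proof -
  have double: "inf \<bar>u\<bar> \<bar>v\<bar> + inf \<bar>u\<bar> \<bar>v\<bar> \<le> \<bar>v\<bar>"
    if "\<And>t. \<bar>t\<bar> = 1/2 \<Longrightarrow> \<bar>u\<bar> \<le> \<bar>u + t *\<^sub>R v\<bar>" for u v :: 'a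
  proof -
    define w where "w = inf \<bar>u\<bar> \<bar>v\<bar>"
    have w: "0 \<le> w" "w \<le> \<bar>u\<bar>" "w \<le> \<bar>v\<bar>" by (simp_all add: w_def)
    have "(1/2) *\<^sub>R w \<le> w"
      using scaleR_right_mono[of "1/2" 1 w] w by simp
    then have "(1/2) *\<^sub>R w \<le> inf \<bar>u\<bar> \<bar>(1/2) *\<^sub>R v\<bar>"
      using w scaleR_left_mono[OF w(3), of "1/2"] order_trans
      by (auto simp: abs_scaleR_banach_lattice)
    then have "(1/2) *\<^sub>R w + (1/2) *\<^sub>R w \<le> inf \<bar>u\<bar> \<bar>(1/2) *\<^sub>R v\<bar> + inf \<bar>u\<bar> \<bar>(1/2) *\<^sub>R v\<bar>"
      by (rule add_mono) fact
    also have "\<dots> \<le> \<bar>(1/2) *\<^sub>R v\<bar>"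
      using that[of "1/2"] that[of "-1/2"] by (intro double_inf_abs_le) simp_all
    finally have "w \<le> (1/2) *\<^sub>R \<bar>v\<bar>"
      by (simp add: abs_scaleR_banach_lattice flip: scaleR_left_distrib)
    from add_mono[OF this this] show ?thesis
      by (simp add: w_def flip: scaleR_left_distrib)
  qed
  define w where "w = inf \<bar>x\<bar> \<bar>y\<bar>"
  have "w + w \<le> \<bar>x\<bar>" "w + w \<le> \<bar>y\<bar>"
    using double[OF assms(1)] double[OF assms(2)] by (simp_all add: w_def inf_commute)
  then have "w + w \<le> w"
    unfolding w_def by (rule inf_greatest)
  then have "w \<le> 0"
    by simp
  then have "w = 0"
    by (rule antisym) (simp add: w_def)
  then show ?thesis
    by (simp add: disjoint_vectors_def w_def)
qed

text \<open>Testing \<open>t = 1, 1/2, 1/4, \<dots>\<close> doubles the bound on \<open>\<bar>x\<bar> \<sqinter> \<bar>y\<bar>\<close> at every step.\<close>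

lemma disjoint_vectors_if_orthogonal:
  fixes x y :: "'a::banach_lattice"
  assumes "\<And>t. \<bar>x\<bar> \<le> \<bar>x + t *\<^sub>R y\<bar>"
  shows "disjoint_vectors x y"
proof -
  define w where "w = inf \<bar>x\<bar> \<bar>y\<bar>"
  have w: "0 \<le> w" "w \<le> \<bar>x\<bar>" "w \<le> \<bar>y\<bar>" by (simp_all add: w_def)
  have bound: "w \<le> (1/2) ^ n *\<^sub>R \<bar>y\<bar>" for n
  proof (induction n)
    case (Suc n)
    let ?t = "(1/2) ^ n :: real"
    have "w \<le> inf \<bar>x\<bar> \<bar>?t *\<^sub>R y\<bar>"
      using Suc w by (simp add: abs_scaleR_banach_lattice)
    then have "w + w \<le> inf \<bar>x\<bar> \<bar>?t *\<^sub>R y\<bar> + inf \<bar>x\<bar> \<bar>?t *\<^sub>R y\<bar>"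
      by (rule add_mono) fact
    also have "\<dots> \<le> \<bar>?t *\<^sub>R y\<bar>"
      using assms[of ?t] assms[of "- ?t"] by (intro double_inf_abs_le) simp_all
    finally have "(1/2) *\<^sub>R (w + w) \<le> (1/2) *\<^sub>R (?t *\<^sub>R \<bar>y\<bar>)"
      by (intro scaleR_left_mono) (simp_all add: abs_scaleR_banach_lattice)
    then show ?case
      by (simp add: scaleR_right_distrib flip: scaleR_left_distrib)
  qed (use w in simp)
  \<comment> \<open>Passing to norms turns the order bounds into numbers that tend to 0.\<close>
  have "norm w \<le> (1/2) ^ n * norm y" for n
    using norm_mono_abs[of w "(1/2) ^ n *\<^sub>R \<bar>y\<bar>"] bound[of n] w
    by (simp add: abs_scaleR_banach_lattice norm_abs_banach_lattice)
  moreover have "(\<lambda>n. (1/2) ^ n * norm y) \<longlonglongrightarrow> 0"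
    by (intro tendsto_mult_left_zero LIMSEQ_power_zero) simp
  ultimately have "norm w \<le> 0"
    by (intro LIMSEQ_le_const) auto
  then show ?thesis
    by (simp add: disjoint_vectors_def w_def)
qed

text \<open>Strict monotonicity enters here: the supremum dominates \<open>|s m|\<close> without
  exceeding it in norm, so the two agree.\<close>

lemma abs_le_of_norm_Sup_fin_le:
  fixes s :: "nat \<Rightarrow> 'a::banach_lattice"
  assumes "strictly_monotone_norm TYPE('a)"
    and "norm (Sup_fin ((\<lambda>n. \<bar>s n\<bar>) ` {1..m})) \<le> norm (s m)"
    and "n \<in> {1..m}"
  shows "\<bar>s n\<bar> \<le> \<bar>s m\<bar>"
proof -
  define u where "u = Sup_fin ((\<lambda>n. \<bar>s n\<bar>) ` {1..m})"
  have le: "\<bar>s k\<bar> \<le> u" if "k \<in> {1..m}" for k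
    unfolding u_def using that by (intro Sup_fin.coboundedI) auto
  have m: "m \<in> {1..m}" using assms(3) by simp
  have "\<bar>u\<bar> = u"
    using le[OF m] by (meson abs_ge_zero abs_of_nonneg order_trans)
  moreover have "\<not> \<bar>s m\<bar> < \<bar>u\<bar>"
    using assms(1,2) unfolding strictly_monotone_norm_def u_def by (meson not_less)
  ultimately have "\<bar>s m\<bar> = u"
    using le[OF m] by (simp add: less_le)
  with le[OF assms(3)] show ?thesis by simp
qed

section \<open>Bases and greedy sums\<close>

lemma schauder_basis_of_coeff_sums:
  assumes "schauder_basis_of E e" and "x \<in> E"
  shows "(\<lambda>n. basis_coeff e n x *\<^sub>R e n) sums x"
  using theI'[of "\<lambda>a. (\<lambda>n. a n *\<^sub>R e n) sums x"] assms
  by (simp add: schauder_basis_of_def basis_coeff_def)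

lemma schauder_basis_of_coeff_unique:
  assumes "schauder_basis_of E e" and "x \<in> E" and "(\<lambda>n. a n *\<^sub>R e n) sums x"
  shows "basis_coeff e n x = a n"
proof -
  have "(THE a. (\<lambda>n. a n *\<^sub>R e n) sums x) = a"
    using assms by (intro the1_equality) (simp_all add: schauder_basis_of_def)
  then show ?thesis by (simp add: basis_coeff_def)
qed

text \<open>The terms of the expansion tend to 0, and their norms divided by the positive lower
  bound \<open>c\<close> of \<open>norm (e n)\<close> dominate the coefficients.\<close>

lemma basis_coeff_tendsto_0:
  assumes "schauder_basis_of E e" and "semi_normalized e" and "x \<in> E"
  shows "(\<lambda>n. basis_coeff e n x) \<longlonglongrightarrow> 0"
proof -
  define c where "c = (INF n. norm (e n))"
  have c: "0 < c" "c \<le> norm (e n)" for n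
    using assms(2) unfolding c_def semi_normalized_def
    by (auto intro!: cINF_lower bdd_belowI[of _ 0])
  have "(\<lambda>n. basis_coeff e n x *\<^sub>R e n) \<longlonglongrightarrow> 0"
    using schauder_basis_of_coeff_sums[OF assms(1,3)] sums_summable summable_LIMSEQ_zero by blast
  then have lim: "(\<lambda>n. norm (basis_coeff e n x *\<^sub>R e n) / c) \<longlonglongrightarrow> 0"
    using tendsto_divide[OF tendsto_norm_zero tendsto_const, of _ _ c] c by fastforce
  show ?thesis
    by (rule Lim_null_comparison[OF _ lim])
      (use c in \<open>auto intro!: always_eventually simp: field_simps mult_right_mono\<close>)
qed

text \<open>\<open>prec\<close> orders indices by decreasing coefficient modulus, then by size. Each
  member of \<open>A\<close> has finitely many predecessors in \<open>A\<close>, so counting them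
  embeds \<open>A\<close> into the naturals, and \<open>\<sigma>\<close> lists \<open>A\<close> by
  increasing rank.\<close>

lemma natural_greedy_ordering_exists:
  assumes "(\<lambda>n. basis_coeff e n x) \<longlonglongrightarrow> 0"
  shows "\<exists>\<sigma>. natural_greedy_ordering e x \<sigma>"
proof -
  define a where "a n = \<bar>basis_coeff e n x\<bar>" for n
  define prec where "prec i j \<longleftrightarrow> a j < a i \<or> a i = a j \<and> i < j" for i j :: nat
  \<comment> \<open>An infinite support is enumerated exactly; a finite one has to be padded.\<close>
  define A where "A = (if finite (basis_supp e x) then UNIV else basis_supp e x)"
  have A: "infinite A" "basis_supp e x \<subseteq> A"
    by (simp_all add: A_def)
  have large: "finite {i. r \<le> a i}" if "0 < r" for r
  proof -
    have "eventually (\<lambda>n. a n < r) sequentially"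
      using order_tendstoD(2)[OF tendsto_rabs_zero[OF assms] that] by (simp add: a_def)
    then show ?thesis
      by (simp add: eventually_cofinite not_less flip: cofinite_eq_sequentially)
  qed
  \<comment> \<open>A nonzero modulus is reached by only finitely many coefficients, as these tend
    to 0. A zero coefficient occurs in \<open>A\<close> only for finite support, and its
    predecessors are then support elements or smaller indices.\<close>
  have finite_prec: "finite {i \<in> A. prec i j}" if "j \<in> A" for j
  proof (cases "a j = 0")
    case True
    then have "finite (basis_supp e x)"
      using that by (auto simp: A_def a_def basis_supp_def split: if_splits)
    moreover have "{i \<in> A. prec i j} \<subseteq> basis_supp e x \<union> {..<j}"
      using True by (auto simp: prec_def a_def basis_supp_def)
    ultimately show ?thesis
      by (meson finite_UnI finite_lessThan finite_subset)
  next
    case False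
    then have "finite {i. a j \<le> a i}" by (intro large) (simp add: a_def)
    then show ?thesis by (rule rev_finite_subset) (auto simp: prec_def)
  qed
  define rank where "rank j = card {i \<in> A. prec i j}" for j
  have rank_less: "rank i < rank j" if "prec i j" "i \<in> A" "j \<in> A" for i j
    unfolding rank_def
  proof (rule psubset_card_mono[OF finite_prec[OF \<open>j \<in> A\<close>]])
    have "{k \<in> A. prec k i} \<subseteq> {k \<in> A. prec k j}" "i \<notin> {k \<in> A. prec k i}" "i \<in> {k \<in> A. prec k j}"
      using that by (auto simp: prec_def)
    then show "{k \<in> A. prec k i} \<subset> {k \<in> A. prec k j}" by blast
  qed
  have total: "prec i j \<or> prec j i \<or> i = j" for i j
    by (auto simp: prec_def)
  have inj: "inj_on rank A"
    by (rule inj_onI) (metis total rank_less less_irrefl)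
  have inf: "infinite (rank ` A)"
    using A(1) inj by (simp add: finite_image_iff)
  define \<sigma> where "\<sigma> n = inv_into A rank (enumerate (rank ` A) n)" for n
  have \<sigma>_A: "\<sigma> n \<in> A" and rank_\<sigma>: "rank (\<sigma> n) = enumerate (rank ` A) n" for n
    unfolding \<sigma>_def using enumerate_in_set[OF inf, of n]
    by (auto simp: inv_into_into f_inv_into_f)
  have mono: "prec (\<sigma> j) (\<sigma> k)" if "j < k" for j k
    using enumerate_mono[OF that inf] total[of "\<sigma> j" "\<sigma> k"] rank_less[of "\<sigma> k" "\<sigma> j"] \<sigma>_A
    by (auto simp flip: rank_\<sigma>)
  have "j \<in> range \<sigma>" if j: "j \<in> A" for j
  proof -
    obtain n where "enumerate (rank ` A) n = rank j"
      using enumerate_Ex[OF inf imageI[OF j]] by blast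
    then have "\<sigma> n = j"
      using inj j by (simp add: \<sigma>_def)
    then show ?thesis by blast
  qed
  moreover have "inj \<sigma>"
    by (rule injI) (metis mono prec_def less_irrefl linorder_neqE_nat)
  moreover have "decseq (\<lambda>n. a (\<sigma> n))"
    unfolding decseq_def using mono by (metis prec_def less_imp_le le_neq_implies_less order_refl)
  ultimately have "natural_greedy_ordering e x \<sigma>"
    unfolding natural_greedy_ordering_def greedy_ordering_def
    using A(2) mono by (auto simp: a_def prec_def)
  then show ?thesis by blast
qed

lemma greedy_sum_obtain:
  assumes "schauder_basis_of E e" and "semi_normalized e" and "x \<in> E"
  obtains \<sigma> where "greedy_ordering e x \<sigma>"
    and "\<And>m. greedy_sum e m x = (\<Sum>n<m. basis_coeff e (\<sigma> n) x *\<^sub>R e (\<sigma> n))"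
proof
  let ?\<sigma> = "SOME \<sigma>. natural_greedy_ordering e x \<sigma>"
  have "natural_greedy_ordering e x ?\<sigma>"
    using natural_greedy_ordering_exists[OF basis_coeff_tendsto_0[OF assms]] by (rule someI_ex)
  then show "greedy_ordering e x ?\<sigma>"
    by (simp add: natural_greedy_ordering_def)
qed (simp add: greedy_sum_def Let_def)

text \<open>The bounds on \<open>t\<close> exclude ties and a vanishing coefficient, so every greedy
  ordering begins with \<open>i\<close> and then \<open>j\<close>.\<close>

lemma greedy_sum_two_terms:
  assumes "schauder_basis_of E e" and "semi_normalized e" and "subspace E"
    and "i \<noteq> j" and "0 < \<bar>t\<bar>" and "\<bar>t\<bar> < 1"
  shows "greedy_sum e 1 (e i + t *\<^sub>R e j) = e i"
    and "greedy_sum e 2 (e i + t *\<^sub>R e j) = e i + t *\<^sub>R e j"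
proof -
  define x where "x = e i + t *\<^sub>R e j"
  define a where "a = (\<lambda>n. if n = i then 1 else if n = j then t else 0)"
  have "x \<in> E"
    using assms(1,3) by (simp add: x_def schauder_basis_of_def subspace_add subspace_scale)
  have "(\<lambda>n. a n *\<^sub>R e n) sums (\<Sum>n\<in>{i, j}. a n *\<^sub>R e n)"
    by (rule sums_finite) (auto simp: a_def)
  then have "(\<lambda>n. a n *\<^sub>R e n) sums x"
    using assms(4) by (simp add: x_def a_def)
  then have coeff: "basis_coeff e n x = a n" for n
    by (rule schauder_basis_of_coeff_unique[OF assms(1) \<open>x \<in> E\<close>])
  obtain \<sigma> where \<sigma>: "greedy_ordering e x \<sigma>"
    and sum: "\<And>m. greedy_sum e m x = (\<Sum>n<m. basis_coeff e (\<sigma> n) x *\<^sub>R e (\<sigma> n))"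
    using greedy_sum_obtain[OF assms(1,2) \<open>x \<in> E\<close>] by metis
  have inj: "inj \<sigma>" and dec: "\<And>m n. m \<le> n \<Longrightarrow> \<bar>a (\<sigma> n)\<bar> \<le> \<bar>a (\<sigma> m)\<bar>"
    and supp: "{n. a n \<noteq> 0} \<subseteq> range \<sigma>"
    using \<sigma> by (auto simp: greedy_ordering_def basis_supp_def coeff decseq_def)
  have "i \<in> range \<sigma>" "j \<in> range \<sigma>"
    using supp assms(4,5) by (auto simp: a_def)
  then obtain p q where p: "\<sigma> p = i" and q: "\<sigma> q = j" by auto
  \<comment> \<open>The index \<open>i\<close> occurs at some position and the moduli do not
    increase, so the first is at least 1, a value reached only at \<open>i\<close>.\<close>
  have "1 \<le> \<bar>a (\<sigma> 0)\<bar>"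
    using dec[of 0 p] p by (simp add: a_def)
  then have \<sigma>0: "\<sigma> 0 = i"
    using assms(6) by (auto simp: a_def split: if_splits)
  have "1 \<le> q"
    using q \<sigma>0 assms(4) by (cases q) auto
  then have "\<bar>t\<bar> \<le> \<bar>a (\<sigma> 1)\<bar>"
    using dec[of 1 q] q assms(4) by (simp add: a_def)
  moreover have "\<sigma> 1 \<noteq> i"
    using inj \<sigma>0 by (metis injD zero_neq_one)
  ultimately have \<sigma>1: "\<sigma> 1 = j"
    using assms(5) by (auto simp: a_def split: if_splits)
  show "greedy_sum e 1 (e i + t *\<^sub>R e j) = e i"
    using sum[of 1] \<sigma>0 by (simp add: coeff a_def flip: x_def)
  show "greedy_sum e 2 (e i + t *\<^sub>R e j) = e i + t *\<^sub>R e j"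
    using sum[of 2] \<sigma>0 \<sigma>1 assms(4)
    by (simp add: coeff a_def numeral_2_eq_2 flip: x_def)
qed

section \<open>From the norm inequalities to disjointness\<close>

lemma disjoint_if_one_bibasic:
  fixes e :: "nat \<Rightarrow> 'a::banach_lattice"
  assumes "strictly_monotone_norm TYPE('a)" and "one_bibasic e" and "i \<noteq> j"
  shows "disjoint_vectors (e i) (e j)"
proof -
  \<comment> \<open>Partial sums isolate \<open>e i\<close> before \<open>e j\<close> only for
    \<open>i < j\<close>; in return every coefficient \<open>t\<close> may be tested.\<close>
  have "disjoint_vectors (e i) (e j)" if "i < j" for i j
  proof (rule disjoint_vectors_if_orthogonal)
    fix t :: real
    define a where "a = (\<lambda>n. if n = i then 1 else if n = j then t else 0)"
    define s where "s n = (\<Sum>k<n. a k *\<^sub>R e k)" for n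
    \<comment> \<open>Sums run over \<open>k < n\<close>, so \<open>s j\<close> is
      \<open>e i\<close>, and \<open>s (Suc j)\<close> is the first to contain
      \<open>e j\<close>.\<close>
    have "norm (Sup_fin ((\<lambda>n. \<bar>s n\<bar>) ` {1..Suc j})) \<le> norm (s (Suc j))"
      unfolding s_def by (rule assms(2)[unfolded one_bibasic_def, rule_format]) simp
    then have le: "\<bar>s j\<bar> \<le> \<bar>s (Suc j)\<bar>"
      using that by (intro abs_le_of_norm_Sup_fin_le[OF assms(1)]) auto
    have "s j = (\<Sum>k<j. if k = i then e k else 0)"
      unfolding s_def a_def by (rule sum.cong) auto
    then have "s j = e i"
      using that by simp
    moreover have "s (Suc j) = s j + t *\<^sub>R e j"
      using that by (simp add: s_def a_def)
    ultimately show "\<bar>e i\<bar> \<le> \<bar>e i + t *\<^sub>R e j\<bar>"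
      using le by simp
  qed
  with assms(3) show ?thesis
    by (metis disjoint_vectors_sym linorder_neqE_nat)
qed

lemma disjoint_if_one_uniformly_quasi_greedy:
  fixes e :: "nat \<Rightarrow> 'a::banach_lattice"
  assumes "strictly_monotone_norm TYPE('a)" and "subspace E"
    and "schauder_basis_of E e" and "semi_normalized e"
    and "one_uniformly_quasi_greedy E e" and "i \<noteq> j"
  shows "disjoint_vectors (e i) (e j)"
proof -
  have "\<bar>e i\<bar> \<le> \<bar>e i + t *\<^sub>R e j\<bar>" if "i \<noteq> j" "\<bar>t\<bar> = 1/2" for i j t
  proof -
    define x where "x = e i + t *\<^sub>R e j"
    have "x \<in> E"
      using assms(2,3) by (simp add: x_def schauder_basis_of_def subspace_add subspace_scale)
    \<comment> \<open>Since \<open>x\<close> is its own second greedy sum, the hypothesis with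
      \<open>m = 2\<close> compares the supremum with its last member.\<close>
    have sums: "greedy_sum e 1 x = e i" "greedy_sum e 2 x = x"
      unfolding x_def using that by (intro greedy_sum_two_terms[OF assms(3,4,2)]; simp)+
    have "norm (Sup_fin ((\<lambda>n. \<bar>greedy_sum e n x\<bar>) ` {1..2})) \<le> norm (greedy_sum e 2 x)"
      using assms(5) \<open>x \<in> E\<close> unfolding one_uniformly_quasi_greedy_def sums by simp
    from abs_le_of_norm_Sup_fin_le[OF assms(1) this, of 1] show ?thesis
      using sums by (simp add: x_def)
  qed
  then show ?thesis
    using assms(6) by (intro disjoint_vectors_if_halves) auto
qed

section \<open>From disjointness to the norm inequalities\<close>

lemma abs_sum_scaleR_disjoint:
  fixes e :: "nat \<Rightarrow> 'a::banach_lattice"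
  assumes "\<forall>i j. i \<noteq> j \<longrightarrow> disjoint_vectors (e i) (e j)" and "finite A"
  shows "\<bar>\<Sum>k\<in>A. a k *\<^sub>R e k\<bar> = (\<Sum>k\<in>A. \<bar>a k *\<^sub>R e k\<bar>)"
proof (rule abs_sum_disjoint[OF assms(2)])
  fix i j :: nat
  assume "i \<noteq> j"
  then have "disjoint_vectors (e j) (a i *\<^sub>R e i)"
    using assms(1) by (simp add: disjoint_vectors_scaleR)
  then have "disjoint_vectors (a i *\<^sub>R e i) (a j *\<^sub>R e j)"
    by (rule disjoint_vectors_scaleR[OF disjoint_vectors_sym])
  then show "inf \<bar>a i *\<^sub>R e i\<bar> \<bar>a j *\<^sub>R e j\<bar> = 0"
    by (simp add: disjoint_vectors_def)
qed

lemma abs_sum_scaleR_disjoint_mono: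
  fixes e :: "nat \<Rightarrow> 'a::banach_lattice"
  assumes "\<forall>i j. i \<noteq> j \<longrightarrow> disjoint_vectors (e i) (e j)" and "finite B" and "A \<subseteq> B"
  shows "\<bar>\<Sum>k\<in>A. a k *\<^sub>R e k\<bar> \<le> \<bar>\<Sum>k\<in>B. a k *\<^sub>R e k\<bar>"
  using assms(2,3) finite_subset[OF assms(3,2)]
  by (simp add: abs_sum_scaleR_disjoint[OF assms(1)] sum_mono2)

text \<open>The bound \<open>z\<close> may lie outside the family: for greedy sums it is a partial
  sum of the basis expansion.\<close>

lemma norm_Sup_fin_abs_le:
  fixes s :: "nat \<Rightarrow> 'a::banach_lattice"
  assumes "1 \<le> m" and "\<And>n. n \<in> {1..m} \<Longrightarrow> \<bar>s n\<bar> \<le> \<bar>z\<bar>"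
  shows "norm (Sup_fin ((\<lambda>n. \<bar>s n\<bar>) ` {1..m})) \<le> norm z"
proof (rule norm_mono_abs)
  let ?u = "Sup_fin ((\<lambda>n. \<bar>s n\<bar>) ` {1..m})"
  have "\<bar>s 1\<bar> \<le> ?u"
    using assms(1) by (intro Sup_fin.coboundedI) auto
  then have "\<bar>?u\<bar> = ?u"
    by (meson abs_ge_zero abs_of_nonneg order_trans)
  moreover have "?u \<le> \<bar>z\<bar>"
    using assms by (intro Sup_fin.boundedI) auto
  ultimately show "\<bar>?u\<bar> \<le> \<bar>z\<bar>" by simp
qed

lemma one_bibasic_if_disjoint:
  assumes "\<forall>i j. i \<noteq> j \<longrightarrow> disjoint_vectors (e i) (e j)"
  shows "one_bibasic e"
  unfolding one_bibasic_def
  by (intro allI impI norm_Sup_fin_abs_le abs_sum_scaleR_disjoint_mono[OF assms]) auto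

text \<open>All indices used by the first \<open>m\<close> greedy sums lie below some
  \<open>N\<close>, so each partial sum of length at least \<open>N\<close> dominates these greedy
  sums in modulus. The norms of the partial sums tend to \<open>norm x\<close>.\<close>

lemma one_uniformly_quasi_greedy_if_disjoint:
  fixes e :: "nat \<Rightarrow> 'a::banach_lattice"
  assumes "schauder_basis_of E e" and "semi_normalized e"
    and disj: "\<forall>i j. i \<noteq> j \<longrightarrow> disjoint_vectors (e i) (e j)"
  shows "one_uniformly_quasi_greedy E e"
  unfolding one_uniformly_quasi_greedy_def
proof (intro allI impI ballI)
  fix m :: nat and x
  assume m: "1 \<le> m" and "x \<in> E"
  define a where "a n = basis_coeff e n x" for n
  obtain \<sigma> where \<sigma>: "greedy_ordering e x \<sigma>"
    and sum: "\<And>m. greedy_sum e m x = (\<Sum>n<m. a (\<sigma> n) *\<^sub>R e (\<sigma> n))"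
    unfolding a_def using greedy_sum_obtain[OF assms(1,2) \<open>x \<in> E\<close>] by metis
  have "inj_on \<sigma> {..<n}" for n
    using \<sigma> by (auto simp: greedy_ordering_def intro: inj_on_subset)
  \<comment> \<open>Summing over the set of indices, not over positions, lets greedy sums and
    partial sums be compared by inclusion.\<close>
  then have greedy: "greedy_sum e n x = (\<Sum>k\<in>\<sigma> ` {..<n}. a k *\<^sub>R e k)" for n
    by (simp add: sum sum.reindex)
  obtain N where N: "\<sigma> ` {..<m} \<subseteq> {..<N}"
    using finite_nat_iff_bounded[of "\<sigma> ` {..<m}"] by auto
  have "(\<lambda>n. \<Sum>k<n. a k *\<^sub>R e k) \<longlonglongrightarrow> x"
    using schauder_basis_of_coeff_sums[OF assms(1) \<open>x \<in> E\<close>] by (simp add: a_def sums_def)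
  then have lim: "(\<lambda>n. norm (\<Sum>k<n. a k *\<^sub>R e k)) \<longlonglongrightarrow> norm x"
    by (rule tendsto_norm)
  show "norm (Sup_fin ((\<lambda>n. \<bar>greedy_sum e n x\<bar>) ` {1..m})) \<le> norm x"
  proof (rule LIMSEQ_le_const[OF lim], intro exI allI impI)
    fix M
    assume "N \<le> M"
    have "\<sigma> ` {..<n} \<subseteq> {..<M}" if "n \<le> m" for n
    proof -
      have "\<sigma> ` {..<n} \<subseteq> \<sigma> ` {..<m}" "{..<N} \<subseteq> {..<M}"
        using that \<open>N \<le> M\<close> by auto
      with N show ?thesis by (meson order_trans)
    qed
    then show "norm (Sup_fin ((\<lambda>n. \<bar>greedy_sum e n x\<bar>) ` {1..m})) \<le> norm (\<Sum>k<M. a k *\<^sub>R e k)"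
      unfolding greedy using m
      by (intro norm_Sup_fin_abs_le abs_sum_scaleR_disjoint_mono[OF disj]) auto
  qed
qed

theorem proposition3p5:
  fixes E :: "'a::banach_lattice set" and e :: "nat \<Rightarrow> 'a"
  assumes "strictly_monotone_norm TYPE('a)"
    and "subspace E" and "closed E"
    and "schauder_basis_of E e" and "semi_normalized e"
  shows "(one_bibasic e \<longleftrightarrow> one_uniformly_quasi_greedy E e) \<and>
         (one_uniformly_quasi_greedy E e \<longleftrightarrow> (\<forall>i j. i \<noteq> j \<longrightarrow> disjoint_vectors (e i) (e j)))"
  using disjoint_if_one_bibasic[OF assms(1)] one_bibasic_if_disjoint
    disjoint_if_one_uniformly_quasi_greedy[OF assms(1,2,4,5)]
    one_uniformly_quasi_greedy_if_disjoint[OF assms(4,5)]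
  by blast

end
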